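(* Let $\mathcal{H}_1,\mathcal{H}_2$ be real or complex Hilbert spaces, $M\subseteq\mathcal{H}_1$ and $N\subseteq\mathcal{H}_2$ closed subspaces, and let $T\in\mathcal{B}(\mathcal{H}_1,\mathcal{H}_2)$ have block form $T=\begin{pmatrix}A&B\\C&D\end{pmatrix}$ with respect to $\mathcal{H}_1=M\oplus M^\perp$ and $\mathcal{H}_2=N\oplus N^\perp$. Assume that $T$ is $(M,N)$-complementable. (1) If $T(M^\perp)\perp N$, then $\|T_{/(M,N)}x\|\le\|Tx\|$ for all $x\in M$. (2) If $T(M)\perp T(M^\perp)$, then $\|T_{/(M,N)}x\|\ge\|Tx\|$ for all $x\in M$.
   Context: $\mathcal{B}(\mathcal{H},\mathcal{K})$ is the space of bounded linear operators; $\mathcal{R}(\cdot)$ and $\mathcal{N}(\cdot)$ denote range and null space. Block entries: $A:M\to N$, $B:M^\perp\to N$, $C:M\to N^\perp$, $D:M^\perp\to N^\perp$, all bounded. $T$ is $(M,N)$-complementable if $\mathcal{R}(C)\subseteq\mathcal{R}(D)$ and $\mathcal{R}(B^* )\subseteq\mathcal{R}(D^* )$. If $\mathcal{R}(A_1)\subseteq\mathcal{R}(B_1)$ for bounded operators $A_1,B_1$ with the same codomain, the Douglas reduced solution of $A_1=B_1X$ is the unique bounded $C_1$ with $A_1=B_1C_1$ and $\mathcal{R}(C_1)\subseteq\mathcal{N}(B_1)^\perp$. For $(M,N)$-complementable $T$, the Schur complement is $T_{/(M,N)}=\begin{pmatrix}A-BZ&0\\0&0\end{pmatrix}=\begin{pmatrix}A-YC&0\\0&0\end{pmatrix}$,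 where $Z$ is the Douglas reduced solution of $C=DX$ and $Y^*$ is the Douglas reduced solution of $B^*=D^*X$. A vector $x\in M$ is identified with $(x,0)\in M\oplus M^\perp$. *)

theory Defs
  imports "HOL-Analysis.Analysis"
begin

text \<open>
  The scalar field is a type of the following class. Its instances are the real and the complex
  numbers, and up to isomorphism there are no others; see \<open>rc_scalar_real_or_complex\<close>.
\<close>

class rc_scalar = real_normed_field +
  fixes rc_cnj :: "'a \<Rightarrow> 'a"
  assumes rc_cnj_add: "rc_cnj (x + y) = rc_cnj x + rc_cnj y"
    and rc_cnj_mult: "rc_cnj (x * y) = rc_cnj x * rc_cnj y"
    and rc_cnj_scaleR_one: "rc_cnj (r *\<^sub>R 1) = r *\<^sub>R 1"
    and mult_rc_cnj_scaleR: "x * rc_cnj x = (norm x)\<^sup>2 *\<^sub>R 1"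

lemma rc_cnj_of_real: "rc_cnj (of_real r :: 'k::rc_scalar) = of_real r"
  by (simp add: of_real_def rc_cnj_scaleR_one)

lemma mult_rc_cnj: "x * rc_cnj x = (of_real ((norm x)\<^sup>2) :: 'k::rc_scalar)"
  by (simp add: of_real_def mult_rc_cnj_scaleR)

instantiation real :: rc_scalar
begin
definition rc_cnj_real :: "real \<Rightarrow> real" where "rc_cnj_real x = x"
instance by standard (auto simp: rc_cnj_real_def power2_eq_square)
end

instantiation complex :: rc_scalar
begin
definition rc_cnj_complex :: "complex \<Rightarrow> complex" where "rc_cnj_complex = cnj"
instance
  by standard (auto simp: rc_cnj_complex_def scaleR_conv_of_real complex_norm_square[symmetric])
end

lemma rc_scalar_real_part: "\<exists>r. x + rc_cnj x = (of_real r :: 'k::rc_scalar)"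
proof -
  have "rc_cnj (1 :: 'k) = 1"
    using rc_cnj_scaleR_one[of 1] by simp
  then have "(x + 1) * (rc_cnj x + 1) = of_real ((norm (x + 1))\<^sup>2)"
    using mult_rc_cnj[of "x + 1"] by (simp add: rc_cnj_add)
  then have "x + rc_cnj x = of_real ((norm (x + 1))\<^sup>2 - (norm x)\<^sup>2 - 1)"
    using mult_rc_cnj[of x] by (simp add: algebra_simps)
  then show ?thesis ..
qed

lemma rc_scalar_real_or_complex:
  "(UNIV :: 'k::rc_scalar set) = \<real> \<or>
   (\<exists>i :: 'k. i * i = -1 \<and> rc_cnj i = - i \<and> (\<forall>x. \<exists>a b. x = of_real a + of_real b * i))"
proof (cases "(UNIV :: 'k set) = \<real>")
  case False
  have split: "\<exists>a u. x = of_real a + u \<and> rc_cnj u = - u" for x :: 'k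
  proof -
    obtain r where r: "x + rc_cnj x = of_real r" using rc_scalar_real_part by blast
    have "rc_cnj (of_real (r/2) + (x - of_real (r/2))) = of_real (r/2) + rc_cnj (x - of_real (r/2))"
      by (simp only: rc_cnj_add rc_cnj_of_real)
    then have "rc_cnj (x - of_real (r/2)) = rc_cnj x - of_real (r/2)" by (simp add: algebra_simps)
    also have "rc_cnj x = of_real (r/2) + of_real (r/2) - x"
      using r by (simp add: algebra_simps flip: of_real_add)
    finally have "rc_cnj (x - of_real (r/2)) = - (x - of_real (r/2))" by simp
    then show ?thesis by (metis add.commute diff_add_cancel)
  qed
  obtain z :: 'k where z: "z \<notin> \<real>" using False by auto
  obtain a w where w: "z = of_real a + w" "rc_cnj w = - w" using split by blast
  have "w \<noteq> 0" using z w by auto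
  define i where "i = of_real (inverse (norm w)) * w"
  have ci: "rc_cnj i = - i" unfolding i_def by (simp only: rc_cnj_mult rc_cnj_of_real w) simp
  have "norm i = 1" using \<open>w \<noteq> 0\<close> by (simp add: i_def norm_mult norm_inverse)
  then have ii: "i * i = -1" using mult_rc_cnj[of i] ci by (simp add: equation_minus_iff)
  have "\<exists>a b. x = of_real a + of_real b * i" for x
  proof -
    obtain c u where u: "x = of_real c + u" "rc_cnj u = - u" using split by blast
    obtain r where "u * i + rc_cnj (u * i) = of_real r" using rc_scalar_real_part by blast
    then have "2 * (u * i) = of_real r" by (simp add: rc_cnj_mult u ci mult.commute)
    then have "u * i = of_real (r / 2)" by (simp add: field_simps)
    moreover have "u = - (u * i) * i" using ii by (simp add: mult.assoc)
    ultimately have "u = of_real (- (r / 2)) * i" by (metis of_real_minus)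
    then show ?thesis using u by blast
  qed
  then show ?thesis using ci ii by blast
qed simp

text \<open>
  A Hilbert space over the scalars \<open>'k\<close>. The inner product is linear in its first argument; the
  norm and the completeness are those of the underlying Banach space \<open>'a\<close>.
\<close>

locale hilbert_space = vector_space scale
  for scale :: "'k::rc_scalar \<Rightarrow> 'a::banach \<Rightarrow> 'a" +
  fixes ip :: "'a \<Rightarrow> 'a \<Rightarrow> 'k"
  assumes scale_of_real: "scale (of_real r) x = r *\<^sub>R x"
    and ip_add_left: "ip (x + y) z = ip x z + ip y z"
    and ip_scale_left: "ip (scale c x) y = c * ip x y"
    and ip_commute: "ip y x = rc_cnj (ip x y)"
    and ip_self: "ip x x = of_real ((norm x)\<^sup>2)"

lemma hilbert_space_real: "hilbert_space (*\<^sub>R) ((\<bullet>) :: 'a::{real_inner,banach} \<Rightarrow> 'a \<Rightarrow> real)"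
  by unfold_locales
    (auto simp: algebra_simps inner_commute rc_cnj_real_def power2_norm_eq_inner)

lemma hilbert_space_complex: "hilbert_space (*) (\<lambda>x y :: complex. x * cnj y)"
  by unfold_locales
    (auto simp: algebra_simps rc_cnj_complex_def scaleR_conv_of_real complex_norm_square[symmetric])

definition orthogonal_sets :: "('a \<Rightarrow> 'a \<Rightarrow> 'k::rc_scalar) \<Rightarrow> 'a set \<Rightarrow> 'a set \<Rightarrow> bool" where
  "orthogonal_sets ip U V \<longleftrightarrow> (\<forall>u\<in>U. \<forall>v\<in>V. ip u v = 0)"

definition orthocomp :: "('a \<Rightarrow> 'a \<Rightarrow> 'k::rc_scalar) \<Rightarrow> 'a set \<Rightarrow> 'a set" where
  "orthocomp ip U = {x. \<forall>u\<in>U. ip u x = 0}"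

definition closed_subspace :: "('k::rc_scalar \<Rightarrow> 'a::banach \<Rightarrow> 'a) \<Rightarrow> 'a set \<Rightarrow> bool" where
  "closed_subspace s U \<longleftrightarrow> module.subspace s U \<and> closed U"

definition proj :: "('a::banach \<Rightarrow> 'a \<Rightarrow> 'k::rc_scalar) \<Rightarrow> 'a set \<Rightarrow> 'a \<Rightarrow> 'a" where
  "proj ip U x = (THE p. p \<in> U \<and> x - p \<in> orthocomp ip U)"

text \<open>
  An operator between closed subspaces \<open>U\<close> and \<open>V\<close> is an element of \<open>U \<rightarrow>\<^sub>E V\<close>, that is, a
  function which is \<open>undefined\<close> outside \<open>U\<close>, so that it is determined by its values on \<open>U\<close>.
  Its range is the image of \<open>U\<close>.
\<close>

definition bounded_ops ::
  "('k::rc_scalar \<Rightarrow> 'a::banach \<Rightarrow> 'a) \<Rightarrow> ('k \<Rightarrow> 'b::banach \<Rightarrow> 'b) \<Rightarrow> 'a set \<Rightarrow> 'b set \<Rightarrow> ('a \<Rightarrow> 'b) set"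
where
  "bounded_ops s\<^sub>1 s\<^sub>2 U V = {S \<in> U \<rightarrow>\<^sub>E V.
     (\<forall>x\<in>U. \<forall>y\<in>U. S (x + y) = S x + S y) \<and>
     (\<forall>c. \<forall>x\<in>U. S (s\<^sub>1 c x) = s\<^sub>2 c (S x)) \<and>
     (\<exists>K. \<forall>x\<in>U. norm (S x) \<le> K * norm x)}"

definition null_space :: "'a set \<Rightarrow> ('a \<Rightarrow> 'b::zero) \<Rightarrow> 'a set" where
  "null_space U S = {x \<in> U. S x = 0}"

definition adjoint_op ::
  "('a \<Rightarrow> 'a \<Rightarrow> 'k::rc_scalar) \<Rightarrow> ('b \<Rightarrow> 'b \<Rightarrow> 'k) \<Rightarrow> 'a set \<Rightarrow> 'b set \<Rightarrow> ('a \<Rightarrow> 'b) \<Rightarrow> 'b \<Rightarrow> 'a"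
where
  "adjoint_op ip\<^sub>1 ip\<^sub>2 U V S =
     (THE R. R \<in> V \<rightarrow>\<^sub>E U \<and> (\<forall>u\<in>U. \<forall>v\<in>V. ip\<^sub>2 (S u) v = ip\<^sub>1 u (R v)))"

text \<open>
  The entry of \<open>T\<close> that maps the summand \<open>U\<close> of the domain to the summand \<open>V\<close> of the codomain.
\<close>

definition block :: "('b::banach \<Rightarrow> 'b \<Rightarrow> 'k::rc_scalar) \<Rightarrow> ('a \<Rightarrow> 'b) \<Rightarrow> 'a set \<Rightarrow> 'b set \<Rightarrow> 'a \<Rightarrow> 'b" where
  "block ip\<^sub>2 T U V = (\<lambda>x\<in>U. proj ip\<^sub>2 V (T x))"

text \<open>
  The reduced solution \<open>X : U \<rightarrow> W\<close> of \<open>A = B X\<close>, where \<open>A\<close> has domain \<open>U\<close> and \<open>B\<close> has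
  domain \<open>W\<close>. As \<open>X\<close> takes values in \<open>W\<close>, it makes no difference whether the orthogonal
  complement of the null space is formed in \<open>W\<close> or in the whole space.
\<close>

definition douglas_solution ::
  "('k::rc_scalar \<Rightarrow> 'a::banach \<Rightarrow> 'a) \<Rightarrow> ('k \<Rightarrow> 'c::banach \<Rightarrow> 'c) \<Rightarrow> ('c \<Rightarrow> 'c \<Rightarrow> 'k) \<Rightarrow>
   'a set \<Rightarrow> 'c set \<Rightarrow> ('a \<Rightarrow> 'b::zero) \<Rightarrow> ('c \<Rightarrow> 'b) \<Rightarrow> 'a \<Rightarrow> 'c"
where
  "douglas_solution s\<^sub>U s\<^sub>W ip\<^sub>W U W A B =
     (THE X. X \<in> bounded_ops s\<^sub>U s\<^sub>W U W \<and> (\<forall>x\<in>U. A x = B (X x)) \<and>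
             X ` U \<subseteq> orthocomp ip\<^sub>W (null_space W B))"

definition complementable ::
  "('a::banach \<Rightarrow> 'a \<Rightarrow> 'k::rc_scalar) \<Rightarrow> ('b::banach \<Rightarrow> 'b \<Rightarrow> 'k) \<Rightarrow>
   'a set \<Rightarrow> 'b set \<Rightarrow> ('a \<Rightarrow> 'b) \<Rightarrow> bool"
where
  "complementable ip\<^sub>1 ip\<^sub>2 M N T \<longleftrightarrow>
     (let M' = orthocomp ip\<^sub>1 M; N' = orthocomp ip\<^sub>2 N;
          B = block ip\<^sub>2 T M' N; C = block ip\<^sub>2 T M N'; D = block ip\<^sub>2 T M' N'
      in C ` M \<subseteq> D ` M' \<and>
         adjoint_op ip\<^sub>1 ip\<^sub>2 M' N B ` N \<subseteq> adjoint_op ip\<^sub>1 ip\<^sub>2 M' N' D ` N')"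

text \<open>
  The operator with block matrix \<open>(A - B Z, 0; 0, 0)\<close>: it applies \<open>A - B Z\<close> to the
  component of \<open>x\<close> in \<open>M\<close>. Where \<open>Y\<^sup>*\<close> is the reduced solution of \<open>B\<^sup>* = D\<^sup>* X\<close>,
  the upper left entry also equals \<open>A - Y C\<close>, as \<open>B Z = Y D Z = Y C\<close>.
\<close>

definition schur_complement ::
  "('k::rc_scalar \<Rightarrow> 'a::banach \<Rightarrow> 'a) \<Rightarrow> ('a \<Rightarrow> 'a \<Rightarrow> 'k) \<Rightarrow> ('b::banach \<Rightarrow> 'b \<Rightarrow> 'k) \<Rightarrow>
   'a set \<Rightarrow> 'b set \<Rightarrow> ('a \<Rightarrow> 'b) \<Rightarrow> 'a \<Rightarrow> 'b"
where
  "schur_complement s\<^sub>1 ip\<^sub>1 ip\<^sub>2 M N T x =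
     (let M' = orthocomp ip\<^sub>1 M; N' = orthocomp ip\<^sub>2 N;
          A = block ip\<^sub>2 T M N; B = block ip\<^sub>2 T M' N;
          C = block ip\<^sub>2 T M N'; D = block ip\<^sub>2 T M' N';
          Z = douglas_solution s\<^sub>1 s\<^sub>1 ip\<^sub>1 M M' C D;
          m = proj ip\<^sub>1 M x
      in A m - B (Z m))"

end

theory Submission
  imports Defs
begin

text \<open>
  Let \<open>Z\<close> be the reduced solution of \<open>C = D X\<close> and let \<open>x \<in> M\<close>. The vector \<open>Z x\<close> lies in
  the orthogonal complement of \<open>M\<close>, and subtracting it from \<open>x\<close> cancels the lower component of
  \<open>T x\<close>: that of \<open>T (x - Z x)\<close> is \<open>C x - D (Z x) = 0\<close>, while the upper one is
  \<open>A x - B (Z x)\<close>. Hence the Schur complement maps \<open>x\<close> to \<open>T x - T (Z x)\<close>, and this is also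
  \<open>P (T x) - P (T (Z x))\<close> for the orthogonal projection \<open>P\<close> onto \<open>N\<close>
  (\<open>schur_complement_eq_image\<close>).

  If \<open>T\<close> maps the complement of \<open>M\<close> into that of \<open>N\<close>, then \<open>P (T (Z x)) = 0\<close>, so the value is
  \<open>P (T x)\<close>, and projections do not increase norms. If \<open>T\<close> maps \<open>M\<close> and its complement to
  orthogonal sets, then \<open>T x\<close> is orthogonal to \<open>T (Z x)\<close>, and the theorem of Pythagoras bounds
  \<open>norm (T x - T (Z x))\<close> from below by \<open>norm (T x)\<close>.

  The main work is Douglas' lemma, that is, the existence of the bounded operator \<open>Z\<close>
  (\<open>douglas_solution_unique_exists\<close>). The solutions \<open>z\<close> of \<open>D z = C x\<close> orthogonal to the null
  space of \<open>D\<close> are unique, hence linear in \<open>x\<close>, and among all solutions they have the least norm.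
  So boundedness reduces to finding, for every \<open>x\<close>, some solution with \<open>norm z \<le> K * norm x\<close>
  (\<open>bounded_lift\<close>). This is a Baire category argument: the sets of those \<open>x\<close> for which a
  solution of norm at most \<open>n\<close> exists cover \<open>M\<close>, and they are closed because a bounded operator
  maps closed balls of a Hilbert space to closed sets. The latter fact replaces weak compactness
  and, like the existence of orthogonal projections, it is an instance of one geometric principle:
  nested nonempty bounded closed convex sets have a common point
  (\<open>nested_convex_Inter_nonempty\<close>).
\<close>

section \<open>Orthogonality and inner product estimates\<close>

lemma rc_cnj_zero: "rc_cnj (0 :: 'k::rc_scalar) = 0"
  using rc_cnj_of_real[of 0] by simp

context hilbert_space
begin

lemma ip_zero_left: "ip 0 y = 0"
  using ip_add_left[of 0 0 y] by simp

lemma ip_zero_right: "ip x 0 = 0"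
  using ip_commute[of x 0] by (simp add: ip_zero_left rc_cnj_zero)

lemma ip_add_right: "ip z (x + y) = ip z x + ip z y"
proof -
  have "ip z (x + y) = rc_cnj (ip (x + y) z)" by (rule ip_commute)
  also have "\<dots> = rc_cnj (ip x z) + rc_cnj (ip y z)" by (simp add: ip_add_left rc_cnj_add)
  finally show ?thesis using ip_commute[where y=z] by metis
qed

lemma ip_scale_right: "ip x (scale c y) = rc_cnj c * ip x y"
  using ip_commute[where y=x] by (metis ip_scale_left rc_cnj_mult)

lemma ip_minus_left: "ip (- x) y = - ip x y"
  using ip_add_left[of x "-x" y] by (simp add: ip_zero_left add_eq_0_iff)

lemma ip_minus_right: "ip x (- y) = - ip x y"
  using ip_add_right[of x y "-y"] by (simp add: ip_zero_right add_eq_0_iff)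

lemma ip_diff_left: "ip (x - y) z = ip x z - ip y z"
  using ip_add_left[of x "-y" z] by (simp add: ip_minus_left)

lemma ip_diff_right: "ip x (y - z) = ip x y - ip x z"
  using ip_add_right[of x y "-z"] by (simp add: ip_minus_right)

lemma ip_eq_0_commute: "ip x y = 0 \<longleftrightarrow> ip y x = 0"
  by (metis ip_commute rc_cnj_zero)

lemma norm_add_pythagoras:
  assumes "ip x y = 0"
  shows "(norm (x + y))\<^sup>2 = (norm x)\<^sup>2 + (norm y)\<^sup>2"
proof -
  have "ip y x = 0" using assms ip_eq_0_commute by blast
  then have "(of_real ((norm (x + y))\<^sup>2) :: 'k) = of_real ((norm x)\<^sup>2 + (norm y)\<^sup>2)"
    using assms ip_self[of "x + y"] ip_self[of x] ip_self[of y]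
    by (simp add: ip_add_left ip_add_right)
  then show ?thesis by (simp only: of_real_eq_iff)
qed

lemma parallelogram_law:
  fixes x y :: 'a
  shows "(norm (x + y))\<^sup>2 + (norm (x - y))\<^sup>2 = 2 * (norm x)\<^sup>2 + 2 * (norm y)\<^sup>2"
proof -
  have "ip (x + y) (x + y) + ip (x - y) (x - y) = 2 * ip x x + 2 * ip y y"
    by (simp add: ip_add_left ip_add_right ip_diff_left ip_diff_right)
  then have "(of_real ((norm (x + y))\<^sup>2 + (norm (x - y))\<^sup>2) :: 'k)
      = of_real (2 * (norm x)\<^sup>2 + 2 * (norm y)\<^sup>2)"
    by (simp add: ip_self)
  then show ?thesis by (simp only: of_real_eq_iff)
qed

text \<open>
  Pythagoras for the component of \<open>x\<close> along \<open>u\<close>. That the left-hand side is nonnegative is the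
  Cauchy-Schwarz inequality; that it drops below \<open>(norm x)\<^sup>2\<close> unless \<open>x\<close> and \<open>u\<close> are orthogonal is
  what makes a nearest point of a subspace an orthogonal projection.
\<close>

lemma norm_diff_component:
  assumes "u \<noteq> 0"
  shows "(norm (x - scale (ip x u / of_real ((norm u)\<^sup>2)) u))\<^sup>2
    = (norm x)\<^sup>2 - (norm (ip x u))\<^sup>2 / (norm u)\<^sup>2"
proof -
  define q where "q = scale (ip x u / of_real ((norm u)\<^sup>2)) u"
  have "ip q u = ip x u"
    using assms by (simp add: q_def ip_scale_left ip_self flip: of_real_power)
  then have "ip (x - q) u = 0" by (simp add: ip_diff_left)
  then have "ip (x - q) q = 0" by (simp add: q_def ip_scale_right)
  then have *: "(norm x)\<^sup>2 = (norm (x - q))\<^sup>2 + (norm q)\<^sup>2"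
    using norm_add_pythagoras[of "x - q" q] by simp
  have "(of_real ((norm q)\<^sup>2) :: 'k) = ip q q" by (simp add: ip_self)
  also have "\<dots> = ip x u / of_real ((norm u)\<^sup>2) * ip u q"
    by (subst q_def) (simp add: ip_scale_left)
  also have "ip u q = rc_cnj (ip x u)"
    using ip_commute[of u q] \<open>ip q u = ip x u\<close> by simp
  also have "ip x u / of_real ((norm u)\<^sup>2) * rc_cnj (ip x u)
      = of_real ((norm (ip x u))\<^sup>2 / (norm u)\<^sup>2)"
    by (simp add: mult_rc_cnj)
  finally have "(norm q)\<^sup>2 = (norm (ip x u))\<^sup>2 / (norm u)\<^sup>2"
    by (simp only: of_real_eq_iff)
  then show ?thesis using * by (simp add: q_def)
qed

lemma norm_ip_le: "norm (ip x u) \<le> norm x * norm u"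
proof (cases "u = 0")
  case False
  then have "(norm (ip x u))\<^sup>2 / (norm u)\<^sup>2 \<le> (norm x)\<^sup>2"
    using norm_diff_component[of u x] by (metis diff_ge_0_iff_ge zero_le_power2)
  then have "(norm (ip x u))\<^sup>2 \<le> (norm x * norm u)\<^sup>2"
    using False by (simp add: field_simps power_mult_distrib)
  then show ?thesis by (rule power2_le_imp_le) simp
qed (simp add: ip_zero_right)

lemma continuous_on_ip_right: "continuous_on S (ip u)"
proof (rule continuous_on_subset[OF _ subset_UNIV])
  have "bounded_linear (ip u)"
  proof (rule bounded_linear_intro)
    show "norm (ip u x) \<le> norm x * norm u" for x
      using norm_ip_le[of u x] by (simp add: mult.commute)
    show "ip u (r *\<^sub>R x) = r *\<^sub>R ip u x" for r x
      by (metis ip_scale_right rc_cnj_of_real scale_of_real scaleR_conv_of_real)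
  qed (simp add: ip_add_right)
  then show "continuous_on UNIV (ip u)"
    by (rule linear_continuous_on)
qed

lemma scaleR_mem_subspace: "subspace U \<Longrightarrow> x \<in> U \<Longrightarrow> r *\<^sub>R x \<in> U"
  by (metis scale_of_real subspace_scale)

lemma convex_subspace: "subspace U \<Longrightarrow> convex U"
  by (intro convexI subspace_add scaleR_mem_subspace)

lemma closed_subspace_orthocomp: "closed_subspace scale (orthocomp ip U)"
proof -
  have "orthocomp ip U = (\<Inter>u\<in>U. {x \<in> UNIV. ip u x = 0})" by (auto simp: orthocomp_def)
  also have "closed \<dots>"
    by (intro closed_INT ballI continuous_closed_preimage_constant continuous_on_ip_right) simp
  finally have "closed (orthocomp ip U)" .
  then show ?thesis
    by (auto simp: closed_subspace_def orthocomp_def ip_zero_right ip_add_right ip_scale_right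
        intro!: subspaceI)
qed

section \<open>Nested convex sets and orthogonal projections\<close>

text \<open>
  The points \<open>z n\<close> of \<open>K n\<close> that nearly minimize the norm form a Cauchy sequence. Indeed, for
  \<open>m \<le> n\<close> the midpoint of \<open>z m\<close> and \<open>z n\<close> lies in the convex set \<open>K m\<close>, so its norm is at least
  the distance \<open>d m\<close> of \<open>K m\<close> from the origin. The parallelogram law then bounds the distance of
  \<open>z m\<close> and \<open>z n\<close> in terms of \<open>L - d m\<close>, where \<open>L\<close> is the limit of the increasing and bounded
  sequence \<open>d\<close>.
\<close>

lemma nested_convex_Inter_nonempty:
  fixes K :: "nat \<Rightarrow> 'a set"
  assumes "decseq K" "\<And>n. closed (K n)" "\<And>n. convex (K n)" "\<And>n. K n \<noteq> {}"
    and "bounded (K 0)"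
  shows "(\<Inter>n. K n) \<noteq> {}"
proof -
  obtain R where R: "\<And>z. z \<in> K 0 \<Longrightarrow> norm z \<le> R"
    using assms(5) by (auto simp: bounded_iff)
  have sub: "K n \<subseteq> K m" if "m \<le> n" for m n
    using assms(1) that by (auto simp: decseq_def)
  define d where "d n = infdist 0 (K n)" for n
  have d_le: "d n \<le> norm z" if "z \<in> K n" for n z
    using infdist_le[OF that, of 0] by (simp add: d_def)
  have d_nonneg: "0 \<le> d n" for n by (simp add: d_def infdist_nonneg)
  have "\<exists>z\<in>K n. norm z < d n + 1 / Suc n" for n
  proof -
    have "(INF a\<in>K n. dist 0 a) < d n + 1 / Suc n"
      using assms(4)[of n] by (simp add: d_def infdist_notempty)
    then show ?thesis
      using assms(4)[of n] by (auto dest: cInf_lessD[rotated])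
  qed
  then obtain z where z: "\<And>n. z n \<in> K n" "\<And>n. norm (z n) < d n + 1 / Suc n"
    by metis
  have "incseq d"
    unfolding incseq_def d_def using sub assms(4) by (intro allI impI infdist_mono) auto
  moreover have "d n \<le> R" for n
    using d_le[OF z(1)[of n]] R[of "z n"] z(1)[of n] sub[of 0 n] by auto
  ultimately obtain L where L: "d \<longlonglongrightarrow> L" "\<And>n. d n \<le> L"
    by (metis incseq_convergent)
  define g where "g n = 4 * (L + 1 / Suc n)\<^sup>2 - 4 * (d n)\<^sup>2" for n
  have "g \<longlonglongrightarrow> 4 * (L + 0)\<^sup>2 - 4 * L\<^sup>2"
    unfolding g_def using L(1) LIMSEQ_Suc[OF lim_1_over_n[where 'a=real]]
    by (intro tendsto_intros) auto
  then have g: "g \<longlonglongrightarrow> 0" by simp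
  have close: "(norm (z m - z n))\<^sup>2 \<le> g m" if "m \<le> n" for m n
  proof -
    have "z n \<in> K m" using z(1) sub[OF that] by auto
    then have "(1/2) *\<^sub>R z m + (1/2) *\<^sub>R z n \<in> K m"
      using convexD[OF assms(3)[of m] z(1)[of m], of "z n" "1/2" "1/2"] by simp
    then have "d m \<le> norm ((1/2) *\<^sub>R (z m + z n))"
      using d_le by (simp only: scaleR_add_right)
    then have "2 * d m \<le> norm (z m + z n)" by simp
    then have "(2 * d m)\<^sup>2 \<le> (norm (z m + z n))\<^sup>2"
      using d_nonneg[of m] by (intro power_mono) auto
    moreover have "(norm (z m))\<^sup>2 \<le> (L + 1 / Suc m)\<^sup>2"
      using z(2)[of m] L(2)[of m] by (intro power_mono) auto
    moreover have "norm (z n) \<le> L + 1 / Suc m"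
    proof -
      have "1 / real (Suc n) \<le> 1 / real (Suc m)"
        using that by (intro divide_left_mono) auto
      then show ?thesis using z(2)[of n] L(2)[of n] by linarith
    qed
    then have "(norm (z n))\<^sup>2 \<le> (L + 1 / Suc m)\<^sup>2"
      by (intro power_mono) auto
    ultimately show ?thesis
      using parallelogram_law[of "z m" "z n"] by (simp add: g_def power_mult_distrib)
  qed
  have "Cauchy z"
  proof (rule CauchyI')
    fix e :: real assume "0 < e"
    then have "\<forall>\<^sub>F n in sequentially. g n < e\<^sup>2"
      using order_tendstoD(2)[OF g] by simp
    then obtain M where M: "\<And>m. m \<ge> M \<Longrightarrow> g m < e\<^sup>2"
      by (auto simp: eventually_sequentially)
    have "dist (z m) (z n) < e" if "m \<ge> M" "n > m" for m n
    proof -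
      have "(norm (z m - z n))\<^sup>2 < e\<^sup>2"
        using close[of m n] M[of m] that by simp
      then show ?thesis
        using \<open>0 < e\<close> by (simp add: dist_norm power_less_imp_less_base)
    qed
    then show "\<exists>M. \<forall>m\<ge>M. \<forall>n>m. dist (z m) (z n) < e" by blast
  qed
  then obtain w where w: "z \<longlonglongrightarrow> w"
    using Cauchy_convergent convergent_def by blast
  have "w \<in> K n" for n
  proof (rule Lim_in_closed_set[OF assms(2) _ _ w])
    show "\<forall>\<^sub>F m in sequentially. z m \<in> K n"
      using z(1) sub[of n] by (auto simp: eventually_sequentially intro!: exI[of _ n])
  qed simp
  then show ?thesis by blast
qed

text \<open>
  A nearest point is a common point of the nested sets of nearly nearest points.
\<close>

lemma orthogonal_projection_exists:
  assumes "closed_subspace scale U"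
  shows "\<exists>p\<in>U. x - p \<in> orthocomp ip U"
proof -
  have U: "subspace U" "closed U" using assms by (auto simp: closed_subspace_def)
  have "0 \<in> U" using U(1) by (rule subspace_0)
  define d where "d = infdist x U"
  define K where "K n = U \<inter> cball x (d + 1 / Suc n)" for n :: nat
  have "(\<Inter>n. K n) \<noteq> {}"
  proof (rule nested_convex_Inter_nonempty)
    show "decseq K"
      unfolding decseq_def K_def
    proof (intro allI impI Int_mono subset_refl subset_cball)
      show "d + 1 / Suc n \<le> d + 1 / Suc m" if "m \<le> n" for m n :: nat
        using that by (intro add_left_mono divide_left_mono) auto
    qed
    show "closed (K n)" for n using U by (auto simp: K_def)
    show "convex (K n)" for n using U by (auto simp: K_def convex_subspace convex_Int)
    show "bounded (K 0)" by (auto simp: K_def)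
    show "K n \<noteq> {}" for n
    proof -
      have "(INF a\<in>U. dist x a) < d + 1 / Suc n"
        using \<open>0 \<in> U\<close> by (auto simp: d_def infdist_def)
      then obtain u where "u \<in> U" "dist x u < d + 1 / Suc n"
        using \<open>0 \<in> U\<close> by (auto dest: cInf_lessD[rotated])
      then show ?thesis by (force simp: K_def)
    qed
  qed
  then obtain p where p: "\<And>n. p \<in> K n" by auto
  have "norm (x - p) \<le> d + 1 / Suc n" for n
    using p[of n] by (simp add: K_def dist_norm)
  moreover have "(\<lambda>n. d + 1 / Suc n) \<longlonglongrightarrow> d + 0"
    using LIMSEQ_Suc[OF lim_1_over_n[where 'a=real]] by (intro tendsto_intros) auto
  ultimately have "norm (x - p) \<le> d + 0"
    by (intro LIMSEQ_le_const) auto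
  then have "norm (x - p) \<le> d" by simp
  have "p \<in> U" using p by (simp add: K_def)
  have "ip u (x - p) = 0" if "u \<in> U" for u
  proof (cases "u = 0")
    case False
    define q where "q = scale (ip (x - p) u / of_real ((norm u)\<^sup>2)) u"
    \<comment> \<open>If \<open>x - p\<close> had a component \<open>q \<noteq> 0\<close> along \<open>u\<close>, then \<open>p + q\<close> would be closer to \<open>x\<close>.\<close>
    have "p + q \<in> U"
      using \<open>p \<in> U\<close> that U(1) by (auto simp: q_def intro: subspace_add subspace_scale)
    then have "d \<le> norm (x - p - q)"
      using infdist_le[of "p + q" U x] by (simp add: d_def dist_norm algebra_simps)
    then have "(norm (x - p))\<^sup>2 \<le> (norm (x - p - q))\<^sup>2"
      using \<open>norm (x - p) \<le> d\<close> by (intro power_mono) auto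
    then have "(norm (ip (x - p) u))\<^sup>2 / (norm u)\<^sup>2 \<le> 0"
      using norm_diff_component[OF False, of "x - p", folded q_def] by linarith
    then have "ip (x - p) u = 0"
      using False by (simp add: divide_le_0_iff)
    then show ?thesis using ip_eq_0_commute by blast
  qed (simp add: ip_zero_left)
  then show ?thesis using \<open>p \<in> U\<close> by (auto simp: orthocomp_def)
qed

lemma mem_orthocomp_self: "x \<in> U \<Longrightarrow> x \<in> orthocomp ip U \<Longrightarrow> x = 0"
  using ip_self[of x] by (auto simp: orthocomp_def)

lemma proj_eqI:
  assumes "closed_subspace scale U" "p \<in> U" "x - p \<in> orthocomp ip U"
  shows "proj ip U x = p"
  unfolding proj_def
proof (rule the_equality)
  fix q assume q: "q \<in> U \<and> x - q \<in> orthocomp ip U"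
  have "subspace U" "subspace (orthocomp ip U)"
    using assms(1) closed_subspace_orthocomp by (auto simp: closed_subspace_def)
  then have "q - p \<in> U" "(x - p) - (x - q) \<in> orthocomp ip U"
    using assms q subspace_diff by blast+
  then show "q = p" using mem_orthocomp_self[of "q - p" U] by simp
qed (use assms in auto)

lemma
  assumes "closed_subspace scale U"
  shows proj_in: "proj ip U x \<in> U" and diff_proj_in: "x - proj ip U x \<in> orthocomp ip U"
  using orthogonal_projection_exists[OF assms, of x] proj_eqI[OF assms] by metis+

lemma proj_id: "closed_subspace scale U \<Longrightarrow> x \<in> U \<Longrightarrow> proj ip U x = x"
  using closed_subspace_orthocomp by (intro proj_eqI) (auto simp: orthocomp_def ip_zero_right)

lemma proj_add:
  assumes "closed_subspace scale U"
  shows "proj ip U (x + y) = proj ip U x + proj ip U y"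
proof (rule proj_eqI[OF assms])
  have "(x - proj ip U x) + (y - proj ip U y) \<in> orthocomp ip U"
    using diff_proj_in[OF assms] closed_subspace_orthocomp
    by (auto simp: closed_subspace_def intro: subspace_add)
  then show "x + y - (proj ip U x + proj ip U y) \<in> orthocomp ip U"
    by (simp add: algebra_simps)
qed (use proj_in[OF assms] assms in \<open>auto simp: closed_subspace_def intro: subspace_add\<close>)

lemma proj_scale:
  assumes "closed_subspace scale U"
  shows "proj ip U (scale c x) = scale c (proj ip U x)"
proof (rule proj_eqI[OF assms])
  have "scale c (x - proj ip U x) \<in> orthocomp ip U"
    using diff_proj_in[OF assms] closed_subspace_orthocomp
    by (auto simp: closed_subspace_def intro: subspace_scale)
  then show "scale c x - scale c (proj ip U x) \<in> orthocomp ip U"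
    by (simp add: scale_right_diff_distrib)
qed (use proj_in[OF assms] assms in \<open>auto simp: closed_subspace_def intro: subspace_scale\<close>)

lemma norm_proj_le:
  assumes "closed_subspace scale U"
  shows "norm (proj ip U x) \<le> norm x"
proof -
  have "ip (proj ip U x) (x - proj ip U x) = 0"
    using proj_in[OF assms, of x] diff_proj_in[OF assms, of x] by (auto simp: orthocomp_def)
  then have "(norm x)\<^sup>2 = (norm (proj ip U x))\<^sup>2 + (norm (x - proj ip U x))\<^sup>2"
    using norm_add_pythagoras by fastforce
  then show ?thesis by (simp add: power2_le_imp_le)
qed

lemma proj_orthocomp:
  assumes "closed_subspace scale U"
  shows "proj ip (orthocomp ip U) x = x - proj ip U x"
proof (rule proj_eqI[OF closed_subspace_orthocomp diff_proj_in[OF assms]])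
  show "x - (x - proj ip U x) \<in> orthocomp ip (orthocomp ip U)"
    using proj_in[OF assms, of x] ip_eq_0_commute by (auto simp: orthocomp_def)
qed

end

section \<open>Bounded operators between closed subspaces\<close>

lemma bounded_ops_add:
    "S \<in> bounded_ops s\<^sub>1 s\<^sub>2 U V \<Longrightarrow> x \<in> U \<Longrightarrow> y \<in> U \<Longrightarrow> S (x + y) = S x + S y"
  and bounded_ops_scale:
    "S \<in> bounded_ops s\<^sub>1 s\<^sub>2 U V \<Longrightarrow> x \<in> U \<Longrightarrow> S (s\<^sub>1 c x) = s\<^sub>2 c (S x)"
  by (auto simp: bounded_ops_def)

context
  fixes s\<^sub>1 :: "'k::rc_scalar \<Rightarrow> 'a::banach \<Rightarrow> 'a" and ip\<^sub>1 :: "'a \<Rightarrow> 'a \<Rightarrow> 'k"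
    and s\<^sub>2 :: "'k \<Rightarrow> 'b::banach \<Rightarrow> 'b" and ip\<^sub>2 :: "'b \<Rightarrow> 'b \<Rightarrow> 'k"
  assumes H1: "hilbert_space s\<^sub>1 ip\<^sub>1" and H2: "hilbert_space s\<^sub>2 ip\<^sub>2"
begin

interpretation X: hilbert_space s\<^sub>1 ip\<^sub>1 by (rule H1)
interpretation Y: hilbert_space s\<^sub>2 ip\<^sub>2 by (rule H2)

lemma bounded_ops_scaleR:
  assumes "S \<in> bounded_ops s\<^sub>1 s\<^sub>2 U V" "x \<in> U"
  shows "S (r *\<^sub>R x) = r *\<^sub>R S x"
  using bounded_ops_scale[OF assms, of "of_real r"] by (simp add: X.scale_of_real Y.scale_of_real)

lemma bounded_ops_diff:
  assumes "S \<in> bounded_ops s\<^sub>1 s\<^sub>2 U V" "X.subspace U" "x \<in> U" "y \<in> U"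
  shows "S (x - y) = S x - S y"
  using bounded_ops_add[OF assms(1), of "x - y" y] assms X.subspace_diff by fastforce

lemma continuous_on_bounded_ops:
  assumes "S \<in> bounded_ops s\<^sub>1 s\<^sub>2 U V" "X.subspace U"
  shows "continuous_on U S"
proof -
  obtain K where K: "\<forall>x\<in>U. norm (S x) \<le> K * norm x"
    using assms(1) by (auto simp: bounded_ops_def)
  have "dist (S x) (S y) \<le> \<bar>K\<bar> * dist x y" if "x \<in> U" "y \<in> U" for x y
  proof -
    have "norm (S (x - y)) \<le> K * norm (x - y)"
      using K X.subspace_diff[OF assms(2) that] by blast
    also have "\<dots> \<le> \<bar>K\<bar> * norm (x - y)" by (intro mult_right_mono) auto
    finally show ?thesis using bounded_ops_diff[OF assms that] by (simp add: dist_norm)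
  qed
  then have "(\<bar>K\<bar>)-lipschitz_on U S" by (intro lipschitz_onI) auto
  then show ?thesis by (rule lipschitz_on_continuous_on)
qed

lemma closed_subspace_null_space:
  assumes "S \<in> bounded_ops s\<^sub>1 s\<^sub>2 U V" "closed_subspace s\<^sub>1 U"
  shows "closed_subspace s\<^sub>1 (null_space U S)"
proof -
  have U: "X.subspace U" "closed U" using assms(2) by (auto simp: closed_subspace_def)
  have "S 0 = 0" using bounded_ops_diff[OF assms(1) U(1), of 0 0] U(1) X.subspace_0 by auto
  then have "X.subspace (null_space U S)"
    using U(1) bounded_ops_add[OF assms(1)] bounded_ops_scale[OF assms(1)]
    by (auto simp: null_space_def intro!: X.subspaceI
        intro: X.subspace_0 X.subspace_add X.subspace_scale)
  moreover have "closed (null_space U S)"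
    unfolding null_space_def
    using continuous_on_bounded_ops[OF assms(1) U(1)] U(2)
    by (rule continuous_closed_preimage_constant)
  ultimately show ?thesis by (simp add: closed_subspace_def)
qed

lemma convex_vimage_bounded_ops:
  assumes "S \<in> bounded_ops s\<^sub>1 s\<^sub>2 U V" "X.subspace U" "convex C"
  shows "convex (U \<inter> S -` C)"
proof (rule convexI)
  fix x y and u v :: real
  assume *: "x \<in> U \<inter> S -` C" "y \<in> U \<inter> S -` C" "0 \<le> u" "0 \<le> v" "u + v = 1"
  have "u *\<^sub>R x \<in> U" "v *\<^sub>R y \<in> U" using * X.scaleR_mem_subspace[OF assms(2)] by auto
  then have "S (u *\<^sub>R x + v *\<^sub>R y) = u *\<^sub>R S x + v *\<^sub>R S y"
    using bounded_ops_add[OF assms(1)] bounded_ops_scaleR[OF assms(1)] * by auto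
  moreover have "u *\<^sub>R S x + v *\<^sub>R S y \<in> C" using * by (auto intro: convexD[OF assms(3)])
  ultimately show "u *\<^sub>R x + v *\<^sub>R y \<in> U \<inter> S -` C"
    using \<open>u *\<^sub>R x \<in> U\<close> \<open>v *\<^sub>R y \<in> U\<close> X.subspace_add[OF assms(2)] by auto
qed

text \<open>
  For \<open>a\<close> in the closure of the image, the points of the ball that are mapped into \<open>1 / (n + 1)\<close>-balls
  around \<open>a\<close> form nested nonempty bounded closed convex sets. A common point of these is mapped
  to \<open>a\<close>.
\<close>

lemma closed_image_ball:
  assumes "S \<in> bounded_ops s\<^sub>1 s\<^sub>2 U V" "closed_subspace s\<^sub>1 U"
  shows "closed (S ` (U \<inter> cball 0 R))"
proof -
  have U: "X.subspace U" "closed U" using assms(2) by (auto simp: closed_subspace_def)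
  have "a \<in> S ` (U \<inter> cball 0 R)" if a: "a \<in> closure (S ` (U \<inter> cball 0 R))" for a
  proof -
    define K where "K n = cball 0 R \<inter> (U \<inter> S -` cball a (1 / Suc n))" for n :: nat
    have "(\<Inter>n. K n) \<noteq> {}"
    proof (rule X.nested_convex_Inter_nonempty)
      show "decseq K"
        unfolding decseq_def K_def
      proof (intro allI impI Int_mono subset_refl vimage_mono subset_cball)
        show "1 / real (Suc n) \<le> 1 / real (Suc m)" if "m \<le> n" for m n :: nat
          using that by (intro divide_left_mono) auto
      qed
      show "closed (K n)" for n
        unfolding K_def using continuous_on_bounded_ops[OF assms(1) U(1)] U(2)
        by (intro closed_Int closed_cball continuous_closed_preimage)
      show "convex (K n)" for n
        unfolding K_def
        by (intro convex_Int convex_cball convex_vimage_bounded_ops[OF assms(1) U(1)])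
      show "bounded (K 0)" by (auto simp: K_def)
      show "K n \<noteq> {}" for n
      proof -
        have "\<exists>y\<in>S ` (U \<inter> cball 0 R). dist y a < 1 / Suc n"
          using a by (intro closure_approachable[THEN iffD1, rule_format]) auto
        then show ?thesis by (fastforce simp: K_def dist_commute)
      qed
    qed
    then obtain z where z: "\<And>n. z \<in> K n" by auto
    have "dist a (S z) \<le> 1 / Suc n" for n using z[of n] by (simp add: K_def)
    then have "dist a (S z) \<le> 0"
      using LIMSEQ_Suc[OF lim_1_over_n[where 'a=real]] by (intro LIMSEQ_le_const) auto
    then show ?thesis using z[of 0] by (auto simp: K_def)
  qed
  then have "closure (S ` (U \<inter> cball 0 R)) \<subseteq> S ` (U \<inter> cball 0 R)" by (rule subsetI)
  then show ?thesis by (simp only: closure_subset_eq)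
qed

lemma block_in_bounded_ops:
  assumes "T \<in> bounded_ops s\<^sub>1 s\<^sub>2 UNIV UNIV" "X.subspace U" "closed_subspace s\<^sub>2 V"
  shows "block ip\<^sub>2 T U V \<in> bounded_ops s\<^sub>1 s\<^sub>2 U V"
proof -
  obtain K where K: "\<And>x. norm (T x) \<le> K * norm x"
    using assms(1) by (auto simp: bounded_ops_def)
  have "norm (proj ip\<^sub>2 V (T x)) \<le> K * norm x" for x
    using Y.norm_proj_le[OF assms(3)] K order_trans by blast
  moreover have "T (x + y) = T x + T y" "T (s\<^sub>1 c x) = s\<^sub>2 c (T x)" for x y c
    using assms(1) by (auto simp: bounded_ops_def)
  ultimately show ?thesis
    using assms X.subspace_add[OF assms(2)] X.subspace_scale[OF assms(2)]
    by (auto simp: bounded_ops_def block_def Y.proj_in Y.proj_add Y.proj_scale)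
qed

end

section \<open>Reduced solutions of operator equations\<close>

text \<open>
  This is where the pointwise inclusion of ranges becomes a uniform bound. By Baire's theorem, some
  set \<open>F n\<close> of points with a solution of norm at most \<open>n\<close> has an interior point \<open>x0\<close>. Every small
  vector is the difference of \<open>x0\<close> and a nearby point of \<open>F n\<close>, hence has a solution of norm at
  most \<open>2 * n\<close>, and scaling gives the result for all vectors.
\<close>

lemma bounded_lift:
  fixes s\<^sub>U :: "'k::rc_scalar \<Rightarrow> 'a::banach \<Rightarrow> 'a" and s\<^sub>W :: "'k \<Rightarrow> 'c::banach \<Rightarrow> 'c"
    and s\<^sub>V :: "'k \<Rightarrow> 'b::banach \<Rightarrow> 'b"
  assumes HU: "hilbert_space s\<^sub>U ip\<^sub>U" and HW: "hilbert_space s\<^sub>W ip\<^sub>W" and HV: "hilbert_space s\<^sub>V ip\<^sub>V"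
    and U: "closed_subspace s\<^sub>U U" and W: "closed_subspace s\<^sub>W W"
    and A: "A \<in> bounded_ops s\<^sub>U s\<^sub>V U V" and B: "B \<in> bounded_ops s\<^sub>W s\<^sub>V W V"
    and ran: "A ` U \<subseteq> B ` W"
  obtains K where "\<And>x. x \<in> U \<Longrightarrow> \<exists>z\<in>W. B z = A x \<and> norm z \<le> K * norm x"
proof -
  interpret U: hilbert_space s\<^sub>U ip\<^sub>U by (rule HU)
  interpret W: hilbert_space s\<^sub>W ip\<^sub>W by (rule HW)
  have subU: "U.subspace U" "closed U" and subW: "W.subspace W"
    using U W by (auto simp: closed_subspace_def)
  have "0 \<in> U" using subU(1) by (rule U.subspace_0)
  define F where "F n = U \<inter> A -` (B ` (W \<inter> cball 0 (real n)))" for n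
  have F: "closed (F n)" for n
    unfolding F_def using continuous_on_bounded_ops[OF HU HV A subU(1)] subU(2)
      closed_image_ball[OF HW HV B W] by (rule continuous_closed_preimage)
  have cover: "(\<Union>n. F n) = U"
  proof -
    have "x \<in> (\<Union>n. F n)" if "x \<in> U" for x
    proof -
      have "A x \<in> B ` W" using ran that by (rule subsetD[OF _ imageI])
      then obtain z where z: "z \<in> W" "A x = B z" by (rule imageE)
      obtain n where "norm z \<le> real n" using real_arch_simple[of "norm z"] ..
      then have "A x \<in> B ` (W \<inter> cball 0 (real n))" using z by auto
      then show ?thesis using that by (auto simp: F_def)
    qed
    then show ?thesis by (auto simp: F_def)
  qed
  have "\<exists>n. top_of_set U interior_of F n \<noteq> {}"
  proof (rule ccontr)
    assume "\<not> ?thesis"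
    moreover have "closedin (top_of_set U) (F n)" for n
      by (rule closed_subset[OF _ F]) (simp add: F_def)
    moreover have "completely_metrizable_space (top_of_set U)"
      using completely_metrizable_space_euclidean subU(2)
      by (rule completely_metrizable_space_closedin[OF _ closed_closedin[THEN iffD1]])
    ultimately have "top_of_set U interior_of (\<Union>(range F)) = {}"
      by (intro Baire_category_alt) auto
    then show False using \<open>0 \<in> U\<close> cover interior_of_topspace[of "top_of_set U"] by auto
  qed
  then obtain n x0 where "x0 \<in> top_of_set U interior_of F n" by blast
  then obtain T where T: "openin (top_of_set U) T" "x0 \<in> T" "T \<subseteq> F n"
    by (auto simp: interior_of_def)
  then obtain r where r: "r > 0" "ball x0 r \<inter> U \<subseteq> T" by (auto simp: openin_contains_ball)
  have "x0 \<in> U" using T by (auto simp: F_def)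
  have "\<exists>z\<in>W. B z = A x \<and> norm z \<le> (4 * n / r) * norm x" if "x \<in> U" for x
  proof (cases "x = 0")
    case True
    have "A 0 = 0" using bounded_ops_diff[OF HU HV A subU(1), of 0 0] \<open>0 \<in> U\<close> by simp
    moreover have "B 0 = 0"
      using bounded_ops_diff[OF HW HV B subW, of 0 0] W.subspace_0[OF subW] by simp
    ultimately show ?thesis using True W.subspace_0[OF subW] by auto
  next
    case False
    \<comment> \<open>With this factor \<open>t *\<^sub>R x\<close> has norm \<open>r / 2\<close>, so that \<open>x0 + t *\<^sub>R x\<close> stays in the ball.\<close>
    define t where "t = r / (2 * norm x)"
    have "t > 0" using False r by (simp add: t_def)
    have tx: "t *\<^sub>R x \<in> U" using U.scaleR_mem_subspace[OF subU(1) that] .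
    then have "x0 + t *\<^sub>R x \<in> U" using \<open>x0 \<in> U\<close> U.subspace_add[OF subU(1)] by blast
    moreover have "x0 + t *\<^sub>R x \<in> ball x0 r" using False r by (simp add: t_def dist_norm)
    ultimately have "x0 + t *\<^sub>R x \<in> F n" using r T by blast
    then obtain z1 where z1: "z1 \<in> W" "norm z1 \<le> n" "A (x0 + t *\<^sub>R x) = B z1"
      by (auto simp: F_def)
    obtain z0 where z0: "z0 \<in> W" "norm z0 \<le> n" "A x0 = B z0"
      using T by (auto simp: F_def)
    have dW: "z1 - z0 \<in> W" using z1 z0 W.subspace_diff[OF subW] by blast
    have "B (z1 - z0) = t *\<^sub>R A x"
      using bounded_ops_diff[OF HW HV B subW z1(1) z0(1)] z1(3) z0(3)
        bounded_ops_add[OF A \<open>x0 \<in> U\<close> tx] bounded_ops_scaleR[OF HU HV A that]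
      by (simp add: diff_eq_eq add.commute)
    then have "B ((1 / t) *\<^sub>R (z1 - z0)) = A x"
      using bounded_ops_scaleR[OF HW HV B dW] \<open>t > 0\<close> by simp
    moreover have "norm ((1 / t) *\<^sub>R (z1 - z0)) \<le> (4 * n / r) * norm x"
    proof -
      have "norm (z1 - z0) \<le> 2 * n" using z1(2) z0(2) norm_triangle_ineq4[of z1 z0] by simp
      then have "(1 / t) * norm (z1 - z0) \<le> (1 / t) * (2 * n)"
        using \<open>t > 0\<close> by (intro mult_left_mono) auto
      then show ?thesis using \<open>t > 0\<close> r(1) by (simp add: t_def mult_ac)
    qed
    ultimately show ?thesis using W.scaleR_mem_subspace[OF subW dW] by blast
  qed
  then show ?thesis using that by blast
qed

text \<open>
  Douglas' lemma. On vectors orthogonal to the null space of \<open>B\<close>, the operator \<open>B\<close> is injective,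
  which yields both the uniqueness of \<open>X\<close> and its linearity. Removing from a solution its component
  in the null space does not increase its norm, so that the bound of \<open>bounded_lift\<close> carries
  over to \<open>X\<close>.
\<close>

lemma douglas_solution_unique_exists:
  fixes s\<^sub>U :: "'k::rc_scalar \<Rightarrow> 'a::banach \<Rightarrow> 'a" and s\<^sub>W :: "'k \<Rightarrow> 'c::banach \<Rightarrow> 'c"
    and s\<^sub>V :: "'k \<Rightarrow> 'b::banach \<Rightarrow> 'b"
  assumes HU: "hilbert_space s\<^sub>U ip\<^sub>U" and HW: "hilbert_space s\<^sub>W ip\<^sub>W" and HV: "hilbert_space s\<^sub>V ip\<^sub>V"
    and U: "closed_subspace s\<^sub>U U" and W: "closed_subspace s\<^sub>W W"
    and A: "A \<in> bounded_ops s\<^sub>U s\<^sub>V U V" and B: "B \<in> bounded_ops s\<^sub>W s\<^sub>V W V"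
    and ran: "A ` U \<subseteq> B ` W"
  shows "\<exists>!X. X \<in> bounded_ops s\<^sub>U s\<^sub>W U W \<and> (\<forall>x\<in>U. A x = B (X x)) \<and>
    X ` U \<subseteq> orthocomp ip\<^sub>W (null_space W B)"
proof -
  interpret U: hilbert_space s\<^sub>U ip\<^sub>U by (rule HU)
  interpret W: hilbert_space s\<^sub>W ip\<^sub>W by (rule HW)
  let ?N = "null_space W B"
  have subU: "U.subspace U" and subW: "W.subspace W"
    using U W by (auto simp: closed_subspace_def)
  have N: "closed_subspace s\<^sub>W ?N" using HW HV B W by (rule closed_subspace_null_space)
  have subN': "W.subspace (orthocomp ip\<^sub>W ?N)"
    using W.closed_subspace_orthocomp by (simp add: closed_subspace_def)
  have unique: "z = z'"
    if "z \<in> W \<inter> orthocomp ip\<^sub>W ?N" "z' \<in> W \<inter> orthocomp ip\<^sub>W ?N" "B z = B z'" for z z'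
  proof -
    have "z - z' \<in> ?N"
      using that bounded_ops_diff[OF HW HV B subW] W.subspace_diff[OF subW]
      by (auto simp: null_space_def)
    moreover have "z - z' \<in> orthocomp ip\<^sub>W ?N"
      using that W.subspace_diff[OF subN'] by auto
    ultimately show ?thesis using W.mem_orthocomp_self[of "z - z'" ?N] by simp
  qed
  define P where "P z = z - proj ip\<^sub>W ?N z" for z
  have P: "P z \<in> W \<inter> orthocomp ip\<^sub>W ?N" "B (P z) = B z" "norm (P z) \<le> norm z"
    if "z \<in> W" for z
  proof -
    have p: "proj ip\<^sub>W ?N z \<in> W" "B (proj ip\<^sub>W ?N z) = 0"
      using W.proj_in[OF N, of z] by (auto simp: null_space_def)
    show "P z \<in> W \<inter> orthocomp ip\<^sub>W ?N"
      using W.diff_proj_in[OF N] W.subspace_diff[OF subW that p(1)] by (simp add: P_def)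
    show "B (P z) = B z"
      using bounded_ops_diff[OF HW HV B subW that p(1)] p(2) by (simp add: P_def)
    show "norm (P z) \<le> norm z"
      using W.norm_proj_le[OF W.closed_subspace_orthocomp] W.proj_orthocomp[OF N]
      by (metis P_def)
  qed
  obtain K where K: "\<And>x. x \<in> U \<Longrightarrow> \<exists>z\<in>W. B z = A x \<and> norm z \<le> K * norm x"
    using bounded_lift[OF assms] by blast
  have "\<exists>z. z \<in> W \<inter> orthocomp ip\<^sub>W ?N \<and> B z = A x \<and> norm z \<le> K * norm x"
    if "x \<in> U" for x
    using K[OF that] P by (metis order_trans)
  then obtain X' where X': "\<And>x. x \<in> U \<Longrightarrow> X' x \<in> W \<inter> orthocomp ip\<^sub>W ?N"
    "\<And>x. x \<in> U \<Longrightarrow> B (X' x) = A x" "\<And>x. x \<in> U \<Longrightarrow> norm (X' x) \<le> K * norm x"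
    by metis
  define X where "X = restrict X' U"
  have X: "X x \<in> W \<inter> orthocomp ip\<^sub>W ?N" "B (X x) = A x" "norm (X x) \<le> K * norm x"
    if "x \<in> U" for x
    using X' that by (auto simp: X_def)
  have "X (x + y) = X x + X y" if "x \<in> U" "y \<in> U" for x y
  proof (rule unique)
    have "x + y \<in> U" using that U.subspace_add[OF subU] by blast
    then show "X (x + y) \<in> W \<inter> orthocomp ip\<^sub>W ?N" using X by blast
    show "X x + X y \<in> W \<inter> orthocomp ip\<^sub>W ?N"
      using X that W.subspace_add[OF subW] W.subspace_add[OF subN'] by auto
    show "B (X (x + y)) = B (X x + X y)"
      using X that \<open>x + y \<in> U\<close> bounded_ops_add[OF B] bounded_ops_add[OF A] by auto
  qed
  moreover have "X (s\<^sub>U c x) = s\<^sub>W c (X x)" if "x \<in> U" for c x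
  proof (rule unique)
    have "s\<^sub>U c x \<in> U" using that U.subspace_scale[OF subU] by blast
    then show "X (s\<^sub>U c x) \<in> W \<inter> orthocomp ip\<^sub>W ?N" using X by blast
    show "s\<^sub>W c (X x) \<in> W \<inter> orthocomp ip\<^sub>W ?N"
      using X that W.subspace_scale[OF subW] W.subspace_scale[OF subN'] by auto
    show "B (X (s\<^sub>U c x)) = B (s\<^sub>W c (X x))"
      using X that \<open>s\<^sub>U c x \<in> U\<close> bounded_ops_scale[OF B] bounded_ops_scale[OF A] by auto
  qed
  moreover have "\<exists>K. \<forall>x\<in>U. norm (X x) \<le> K * norm x"
    using X(3) by blast
  moreover have "X \<in> U \<rightarrow>\<^sub>E W"
    using X(1) by (auto simp: X_def)
  ultimately have "X \<in> bounded_ops s\<^sub>U s\<^sub>W U W"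
    by (simp add: bounded_ops_def)
  then show ?thesis
  proof (intro ex1I[of _ X] conjI ballI)
    fix X2 assume X2: "X2 \<in> bounded_ops s\<^sub>U s\<^sub>W U W \<and> (\<forall>x\<in>U. A x = B (X2 x)) \<and>
      X2 ` U \<subseteq> orthocomp ip\<^sub>W ?N"
    have "X2 \<in> U \<rightarrow>\<^sub>E W" "X \<in> U \<rightarrow>\<^sub>E W"
      using X2 \<open>X \<in> bounded_ops s\<^sub>U s\<^sub>W U W\<close> by (auto simp: bounded_ops_def)
    then show "X2 = X"
      using X2 X by (intro PiE_ext[of _ U "\<lambda>_. W"] unique) auto
  qed (use X in auto)
qed

section \<open>The Schur complement\<close>

text \<open>
  The witness \<open>z\<close> is the value of the reduced solution at \<open>x\<close>: the equation \<open>C x = D z\<close> says that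
  \<open>T x\<close> and \<open>T z\<close> have the same component orthogonal to \<open>N\<close>, so projecting their difference onto
  \<open>N\<close> does not change it.
\<close>

lemma schur_complement_eq_image:
  fixes s\<^sub>1 :: "'k::rc_scalar \<Rightarrow> 'a::banach \<Rightarrow> 'a" and s\<^sub>2 :: "'k \<Rightarrow> 'b::banach \<Rightarrow> 'b"
  assumes H1: "hilbert_space s\<^sub>1 ip\<^sub>1" and H2: "hilbert_space s\<^sub>2 ip\<^sub>2"
    and M: "closed_subspace s\<^sub>1 M" and N: "closed_subspace s\<^sub>2 N"
    and T: "T \<in> bounded_ops s\<^sub>1 s\<^sub>2 UNIV UNIV"
    and compl: "complementable ip\<^sub>1 ip\<^sub>2 M N T"
    and x: "x \<in> M"
  obtains z where "z \<in> orthocomp ip\<^sub>1 M"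
    "schur_complement s\<^sub>1 ip\<^sub>1 ip\<^sub>2 M N T x = T x - T z"
    "schur_complement s\<^sub>1 ip\<^sub>1 ip\<^sub>2 M N T x = proj ip\<^sub>2 N (T x) - proj ip\<^sub>2 N (T z)"
proof -
  interpret X: hilbert_space s\<^sub>1 ip\<^sub>1 by (rule H1)
  interpret Y: hilbert_space s\<^sub>2 ip\<^sub>2 by (rule H2)
  let ?M' = "orthocomp ip\<^sub>1 M" and ?N' = "orthocomp ip\<^sub>2 N"
  let ?C = "block ip\<^sub>2 T M ?N'" and ?D = "block ip\<^sub>2 T ?M' ?N'"
  define Z where "Z = douglas_solution s\<^sub>1 s\<^sub>1 ip\<^sub>1 M ?M' ?C ?D"
  have M': "closed_subspace s\<^sub>1 ?M'" by (rule X.closed_subspace_orthocomp)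
  have N': "closed_subspace s\<^sub>2 ?N'" by (rule Y.closed_subspace_orthocomp)
  have C: "?C \<in> bounded_ops s\<^sub>1 s\<^sub>2 M ?N'"
    using block_in_bounded_ops[OF H1 H2 T _ N'] M by (simp add: closed_subspace_def)
  have D: "?D \<in> bounded_ops s\<^sub>1 s\<^sub>2 ?M' ?N'"
    using block_in_bounded_ops[OF H1 H2 T _ N'] M' by (simp add: closed_subspace_def)
  have "?C ` M \<subseteq> ?D ` ?M'" using compl by (simp add: complementable_def Let_def)
  from theI'[OF douglas_solution_unique_exists[OF H1 H1 H2 M M' C D this]]
  have Z: "Z x \<in> ?M'" "?C x = ?D (Z x)"
    using x by (auto simp: Z_def douglas_solution_def bounded_ops_def)
  have S: "schur_complement s\<^sub>1 ip\<^sub>1 ip\<^sub>2 M N T x = proj ip\<^sub>2 N (T x) - proj ip\<^sub>2 N (T (Z x))"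
    unfolding schur_complement_def Let_def X.proj_id[OF M x] Z_def[symmetric]
    using x Z(1) by (simp add: block_def)
  have "T x - proj ip\<^sub>2 N (T x) = T (Z x) - proj ip\<^sub>2 N (T (Z x))"
    using Z x by (simp add: block_def Y.proj_orthocomp[OF N])
  then have "schur_complement s\<^sub>1 ip\<^sub>1 ip\<^sub>2 M N T x = T x - T (Z x)"
    unfolding S by (metis add_diff_cancel_left' diff_add_cancel diff_diff_eq2 add.commute)
  then show ?thesis using that Z(1) S by blast
qed

theorem theorem3p5:
  fixes s\<^sub>1 :: "'k::rc_scalar \<Rightarrow> 'a::banach \<Rightarrow> 'a" and ip\<^sub>1 :: "'a \<Rightarrow> 'a \<Rightarrow> 'k"
    and s\<^sub>2 :: "'k \<Rightarrow> 'b::banach \<Rightarrow> 'b" and ip\<^sub>2 :: "'b \<Rightarrow> 'b \<Rightarrow> 'k"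
    and M :: "'a set" and N :: "'b set" and T :: "'a \<Rightarrow> 'b"
  assumes "hilbert_space s\<^sub>1 ip\<^sub>1" and "hilbert_space s\<^sub>2 ip\<^sub>2"
    and "closed_subspace s\<^sub>1 M" and "closed_subspace s\<^sub>2 N"
    and "T \<in> bounded_ops s\<^sub>1 s\<^sub>2 UNIV UNIV"
    and "complementable ip\<^sub>1 ip\<^sub>2 M N T"
  shows "(orthogonal_sets ip\<^sub>2 (T ` orthocomp ip\<^sub>1 M) N \<longrightarrow>
            (\<forall>x\<in>M. norm (schur_complement s\<^sub>1 ip\<^sub>1 ip\<^sub>2 M N T x) \<le> norm (T x))) \<and>
         (orthogonal_sets ip\<^sub>2 (T ` M) (T ` orthocomp ip\<^sub>1 M) \<longrightarrow>
            (\<forall>x\<in>M. norm (schur_complement s\<^sub>1 ip\<^sub>1 ip\<^sub>2 M N T x) \<ge> norm (T x)))"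
proof (intro conjI impI ballI)
  interpret Y: hilbert_space s\<^sub>2 ip\<^sub>2 by (rule assms)
  fix x assume x: "x \<in> M"
  obtain z where z: "z \<in> orthocomp ip\<^sub>1 M"
    "schur_complement s\<^sub>1 ip\<^sub>1 ip\<^sub>2 M N T x = T x - T z"
    "schur_complement s\<^sub>1 ip\<^sub>1 ip\<^sub>2 M N T x = proj ip\<^sub>2 N (T x) - proj ip\<^sub>2 N (T z)"
    using schur_complement_eq_image[OF assms x] by blast
  {
    assume "orthogonal_sets ip\<^sub>2 (T ` orthocomp ip\<^sub>1 M) N"
    then have "T z \<in> orthocomp ip\<^sub>2 N"
      using z(1) Y.ip_eq_0_commute by (auto simp: orthogonal_sets_def orthocomp_def)
    moreover have "0 \<in> N"
      using assms(4) Y.subspace_0 by (auto simp: closed_subspace_def)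
    ultimately have "proj ip\<^sub>2 N (T z) = 0"
      using Y.proj_eqI[OF assms(4), of 0 "T z"] by simp
    then show "norm (schur_complement s\<^sub>1 ip\<^sub>1 ip\<^sub>2 M N T x) \<le> norm (T x)"
      using z(3) Y.norm_proj_le[OF assms(4)] by simp
  next
    assume "orthogonal_sets ip\<^sub>2 (T ` M) (T ` orthocomp ip\<^sub>1 M)"
    then have "ip\<^sub>2 (T x) (- T z) = 0"
      using x z(1) by (auto simp: orthogonal_sets_def Y.ip_minus_right)
    then have "(norm (T x - T z))\<^sup>2 = (norm (T x))\<^sup>2 + (norm (T z))\<^sup>2"
      using Y.norm_add_pythagoras[of "T x" "- T z"] by simp
    then have "norm (T x) \<le> norm (T x - T z)" by (simp add: power2_le_imp_le)
    then show "norm (schur_complement s\<^sub>1 ip\<^sub>1 ip\<^sub>2 M N T x) \<ge> norm (T x)" using z(2) by simp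
  }
qed

end
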